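(* Let $X$ be an infinite set, and let $\mathfrak{L}$ be an algebraic lattice with at most $2^{|X|}$ compact elements. Then $\mathfrak{L}$ can be completely embedded into the clone lattice $\mathrm{Cl}(X)$ over $X$; that is, there is an injective map $\mathfrak{L}\to\mathrm{Cl}(X)$ which preserves suprema and infima of arbitrary nonempty families.
   Context: For $n\geq 1$, $\mathscr{O}^{(n)}$ denotes the set of all $n$-ary operations $X^n\to X$, and $\mathscr{O}=\bigcup_{n\geq 1}\mathscr{O}^{(n)}$. For $1\leq i\leq n$ the projection $\pi^n_i\in\mathscr{O}^{(n)}$ is given by $\pi^n_i(x_1,\ldots,x_n)=x_i$. A set $\mathscr{D}\subseteq\mathscr{O}$ is a clone if it contains all projections and is closed under composition (i.e. $f(g_1,\ldots,g_n)\in\mathscr{D}$ whenever $f\in\mathscr{D}$ is $n$-ary and $g_1,\ldots,g_n\in\mathscr{D}$ have the same arity). $\mathrm{Cl}(X)$ is the set of all clones over $X$, ordered by inclusion; it is a complete lattice. An algebraic lattice is a complete lattice in which every element is a supremum of compact elements. *)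

theory Defs
  imports Main "HOL-Library.FuncSet" "HOL-Library.Equipollence"
begin

context complete_lattice
begin

definition compact_element :: "'a \<Rightarrow> bool" where
  "compact_element x \<longleftrightarrow> (\<forall>A. x \<le> Sup A \<longrightarrow> (\<exists>B. finite B \<and> B \<subseteq> A \<and> x \<le> Sup B))"

end

class algebraic_lattice = complete_lattice +
  assumes ex_Sup_compact_elements: "\<exists>A. (\<forall>a\<in>A. compact_element a) \<and> x = Sup A"

text \<open>
  The base set is the universe of the type \<open>'x\<close>, and \<open>n\<close>-tuples are lists of length \<open>n\<close>.
  Functions are extensional, so that an \<open>n\<close>-ary operation is determined by its values on
  \<open>n\<close>-tuples. An operation is tagged with its arity, because extensionality alone does not
  determine it: the function with constant value \<open>undefined\<close> is extensional for every arity.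
\<close>

definition tuples :: "nat \<Rightarrow> 'x list set" where
  "tuples n = {xs. length xs = n}"

type_synonym 'x operation = "nat \<times> ('x list \<Rightarrow> 'x)"

definition operations :: "'x operation set" where
  "operations = (SIGMA n:{1..}. tuples n \<rightarrow>\<^sub>E UNIV)"

text \<open>Coordinates are numbered from \<open>0\<close>, so \<open>proj n i\<close> is \<open>\<pi>\<^sup>n\<close> with lower index \<open>i + 1\<close>.\<close>

definition proj :: "nat \<Rightarrow> nat \<Rightarrow> 'x list \<Rightarrow> 'x" where
  "proj n i = (\<lambda>xs\<in>tuples n. xs ! i)"

definition compose_ops :: "nat \<Rightarrow> ('x list \<Rightarrow> 'x) \<Rightarrow> ('x list \<Rightarrow> 'x) list \<Rightarrow> 'x list \<Rightarrow> 'x" where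
  "compose_ops m f gs = (\<lambda>xs\<in>tuples m. f (map (\<lambda>g. g xs) gs))"

definition is_clone :: "'x operation set \<Rightarrow> bool" where
  "is_clone D \<longleftrightarrow>
     D \<subseteq> operations \<and>
     (\<forall>n i. i < n \<longrightarrow> (n, proj n i) \<in> D) \<and>
     (\<forall>n m f gs. (n, f) \<in> D \<and> length gs = n \<and> (\<forall>g\<in>set gs. (m, g) \<in> D) \<longrightarrow>
        (m, compose_ops m f gs) \<in> D)"

lemma is_clone_operations: "is_clone (operations :: 'x operation set)"
  unfolding is_clone_def
proof (intro conjI allI impI)
  fix n i :: nat
  assume "i < n"
  then show "(n, proj n i) \<in> (operations :: 'x operation set)"
    by (auto simp: operations_def proj_def)
next
  fix n m :: nat and f :: "'x list \<Rightarrow> 'x" and gs :: "('x list \<Rightarrow> 'x) list"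
  assume *: "(n, f) \<in> operations \<and> length gs = n \<and> (\<forall>g\<in>set gs. (m, g) \<in> operations)"
  then have "n \<ge> 1"
    by (auto simp: operations_def)
  with * have "gs ! 0 \<in> set gs"
    by simp
  with * have "(m, gs ! 0) \<in> operations"
    by blast
  then have "m \<ge> 1"
    by (auto simp: operations_def)
  then show "(m, compose_ops m f gs) \<in> operations"
    by (auto simp: operations_def compose_ops_def)
qed simp

lemma is_clone_Inter:
  fixes \<D> :: "'x operation set set"
  assumes "\<And>D. D \<in> \<D> \<Longrightarrow> is_clone D"
  shows "is_clone (operations \<inter> \<Inter>\<D>)"
proof -
  have comp: "(m, compose_ops m f gs) \<in> D"
    if "is_clone D" "(n, f) \<in> D" "length gs = n" "\<forall>g\<in>set gs. (m, g) \<in> D"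
    for D :: "'x operation set" and n m f gs
    using that(1)[unfolded is_clone_def] that(2-4) by simp
  have proj: "(n, proj n i) \<in> D" if "is_clone D" "i < n" for D :: "'x operation set" and n i
    using that by (simp add: is_clone_def)
  show ?thesis
    unfolding is_clone_def[of "operations \<inter> \<Inter>\<D>"]
  proof (intro conjI allI impI)
    fix n i :: nat
    assume "i < n"
    then show "(n, proj n i) \<in> operations \<inter> \<Inter>\<D>"
      using proj assms is_clone_operations by simp
  next
    fix n m :: nat and f :: "'x list \<Rightarrow> 'x" and gs :: "('x list \<Rightarrow> 'x) list"
    assume "(n, f) \<in> operations \<inter> \<Inter>\<D> \<and> length gs = n \<and>
      (\<forall>g\<in>set gs. (m, g) \<in> operations \<inter> \<Inter>\<D>)"
    then show "(m, compose_ops m f gs) \<in> operations \<inter> \<Inter>\<D>"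
      using comp[OF is_clone_operations, of n f gs m] comp[OF assms, of _ n f gs m] by simp
  qed simp
qed

typedef 'x clone = "{D :: 'x operation set. is_clone D}"
  using is_clone_operations by blast

setup_lifting type_definition_clone

instantiation clone :: (type) complete_lattice
begin

lift_definition less_eq_clone :: "'x clone \<Rightarrow> 'x clone \<Rightarrow> bool" is "(\<subseteq>)" .

lift_definition less_clone :: "'x clone \<Rightarrow> 'x clone \<Rightarrow> bool" is "(\<subset>)" .

lift_definition Inf_clone :: "'x clone set \<Rightarrow> 'x clone" is "\<lambda>\<D>. operations \<inter> \<Inter>\<D>"
  by (rule is_clone_Inter) blast

definition Sup_clone :: "'x clone set \<Rightarrow> 'x clone" where
  "Sup_clone \<C> = Inf {D. \<forall>C\<in>\<C>. C \<le> D}"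

definition inf_clone :: "'x clone \<Rightarrow> 'x clone \<Rightarrow> 'x clone" where
  "inf_clone C D = Inf {C, D}"

definition sup_clone :: "'x clone \<Rightarrow> 'x clone \<Rightarrow> 'x clone" where
  "sup_clone C D = Sup {C, D}"

definition bot_clone :: "'x clone" where
  "bot_clone = Sup {}"

definition top_clone :: "'x clone" where
  "top_clone = Inf {}"

instance
proof
  have Inf_lower: "Inf \<C> \<le> C" if "C \<in> \<C>" for C :: "'x clone" and \<C>
    using that by transfer blast
  have Inf_greatest: "D \<le> Inf \<C>" if "\<And>C. C \<in> \<C> \<Longrightarrow> D \<le> C" for D :: "'x clone" and \<C>
    using that by transfer (simp add: is_clone_def le_Inf_iff)
  have Sup_upper: "C \<le> Sup \<C>" if "C \<in> \<C>" for C :: "'x clone" and \<C>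
    unfolding Sup_clone_def by (rule Inf_greatest) (use that in blast)
  have Sup_least: "Sup \<C> \<le> D" if "\<And>C. C \<in> \<C> \<Longrightarrow> C \<le> D" for D :: "'x clone" and \<C>
    unfolding Sup_clone_def by (rule Inf_lower) (use that in blast)
  fix C D E :: "'x clone" and \<C> :: "'x clone set"
  show "C < D \<longleftrightarrow> C \<le> D \<and> \<not> D \<le> C"
    by transfer blast
  show "C \<le> C"
    by transfer blast
  show "C \<le> D \<Longrightarrow> D \<le> E \<Longrightarrow> C \<le> E"
    by transfer blast
  show "C \<le> D \<Longrightarrow> D \<le> C \<Longrightarrow> C = D"
    by transfer blast
  show "inf C D \<le> C" "inf C D \<le> D"
    unfolding inf_clone_def by (rule Inf_lower; simp)+
  show "C \<le> D \<Longrightarrow> C \<le> E \<Longrightarrow> C \<le> inf D E"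
    unfolding inf_clone_def by (rule Inf_greatest) blast
  show "C \<le> sup C D" "D \<le> sup C D"
    unfolding sup_clone_def by (rule Sup_upper; simp)+
  show "D \<le> C \<Longrightarrow> E \<le> C \<Longrightarrow> sup D E \<le> C"
    unfolding sup_clone_def by (rule Sup_least) blast
  show "C \<in> \<C> \<Longrightarrow> Inf \<C> \<le> C"
    by (rule Inf_lower)
  show "(\<And>D. D \<in> \<C> \<Longrightarrow> C \<le> D) \<Longrightarrow> C \<le> Inf \<C>"
    by (rule Inf_greatest)
  show "C \<in> \<C> \<Longrightarrow> C \<le> Sup \<C>"
    by (rule Sup_upper)
  show "(\<And>D. D \<in> \<C> \<Longrightarrow> D \<le> C) \<Longrightarrow> Sup \<C> \<le> C"
    by (rule Sup_least)
  show "Inf {} = (top :: 'x clone)" "Sup {} = (bot :: 'x clone)"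
    by (simp_all add: top_clone_def bot_clone_def)
qed

end

end

theory Submission
  imports Defs "HOL-Algebra.Free_Abelian_Groups"
begin

text \<open>
  Write \<open>K\<close> for the compact elements of the lattice. Freely inserting midpoints produces a set \<open>N\<close>
  of nodes with a \<open>K\<close>-valued, not necessarily symmetric distance \<open>d\<close> such that \<open>d h g \<le> a \<squnion> b\<close>
  implies \<open>d h u \<le> a\<close> and \<open>d u g \<le> b\<close> for some node \<open>u\<close>. As there are at most \<open>2\<^bsup>|X|\<^esup>\<close> nodes, they can
  be coded as subsets of \<open>X\<close>. Split \<open>X\<close> into fibres over the finite subsets \<open>F\<close> of \<open>X\<close>; a node \<open>h\<close>,
  coded by \<open>A \<subseteq> X\<close>, has the trace \<open>A \<inter> F\<close> in the fibre over \<open>F\<close>, and different nodes have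
  different traces once \<open>F\<close> is large. For a pair of nodes \<open>h\<close>, \<open>g\<close> let \<open>edge h g\<close> be the unary
  operation which in each fibre sends the trace of \<open>h\<close> to that of \<open>g\<close> and everything else to a
  fixed dead point. A lattice element \<open>x\<close> is mapped to the clone of essentially unary operations
  whose underlying map preserves fibres and agrees, in the fibres over all large \<open>F\<close>, with the
  identity, with the constant dead map, or with some \<open>edge h g\<close> where \<open>d h g \<le> x\<close>. An edge map
  determines \<open>h\<close> and \<open>g\<close>, which gives infima; midpoints and compactness give suprema.
\<close>

subsection \<open>Compact elements\<close>

lemma compact_bot: "compact_element (bot :: 'l::complete_lattice)"
  unfolding compact_element_def by (auto intro: exI[of _ "{}"])

lemma compact_sup:
  fixes a b :: "'l::complete_lattice"
  assumes "compact_element a" "compact_element b"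
  shows "compact_element (sup a b)"
  unfolding compact_element_def
proof (intro allI impI)
  fix A assume "sup a b \<le> Sup A"
  then have "a \<le> Sup A" "b \<le> Sup A" by simp_all
  then obtain B C where "finite B" "B \<subseteq> A" "a \<le> Sup B" "finite C" "C \<subseteq> A" "b \<le> Sup C"
    using assms unfolding compact_element_def by meson
  then show "\<exists>B. finite B \<and> B \<subseteq> A \<and> sup a b \<le> Sup B"
    by (intro exI[of _ "B \<union> C"]) (auto simp: Sup_union_distrib intro: le_supI1 le_supI2)
qed

lemma compact_Sup_finite:
  fixes C :: "'l::complete_lattice set"
  assumes "finite C" "\<And>c. c \<in> C \<Longrightarrow> compact_element c"
  shows "compact_element (Sup C)"
  using assms by (induction C) (auto intro: compact_bot compact_sup)

lemma le_if_compact_le: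
  fixes x y :: "'l::algebraic_lattice"
  assumes "\<And>k. compact_element k \<Longrightarrow> k \<le> x \<Longrightarrow> k \<le> y"
  shows "x \<le> y"
proof -
  obtain A where "\<forall>a\<in>A. compact_element a" "x = Sup A"
    using ex_Sup_compact_elements[of x] by blast
  then show ?thesis using assms by (auto intro!: Sup_least Sup_upper)
qed

subsection \<open>Distances with midpoints\<close>

text \<open>Costs are labels of type \<open>'a\<close>, decoded by \<open>c\<close>, instead of
  lattice elements, so that nodes can be coded inside an infinite \<open>'a\<close>.\<close>

datatype 'a node = Base 'a | Between "'a node" "'a node" 'a 'a

lemma size_node_neq_0 [simp]: "size (u :: 'a node) \<noteq> 0"
  by (cases u) auto

context
  fixes c :: "'a \<Rightarrow> 'l::complete_lattice"
begin

text \<open>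
  The midpoint \<open>Between h g A B\<close> can be entered only from \<open>h\<close>, at cost \<open>c A\<close>, and left only
  towards \<open>g\<close>. The cost of leaving is \<open>c B\<close> unless this would create a short cut from \<open>h\<close> to \<open>g\<close>.
\<close>

function node_dist :: "'a node \<Rightarrow> 'a node \<Rightarrow> 'l" where
  "node_dist (Base A) (Base B) = (if A = B then bot else sup (c A) (c B))"
| "node_dist (Base A) (Between h g C D) = sup (node_dist (Base A) h) (c C)"
| "node_dist (Between h g C D) (Base A) =
     sup (if node_dist h g \<le> sup (c C) (c D) then c D else node_dist h g) (node_dist g (Base A))"
| "node_dist (Between h g C D) (Between h' g' C' D') =
     (if Between h g C D = Between h' g' C' D' then bot
      else if size (Between h' g' C' D') \<le> size (Between h g C D)
      then sup (if node_dist h g \<le> sup (c C) (c D) then c D else node_dist h g)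
             (node_dist g (Between h' g' C' D'))
      else sup (node_dist (Between h g C D) h') (c C'))"
  by pat_completeness auto
termination by (relation "measure (\<lambda>(u, v). size u + size v)") auto

definition exit_cost :: "'a node \<Rightarrow> 'a node \<Rightarrow> 'a \<Rightarrow> 'a \<Rightarrow> 'l" where
  "exit_cost h g A B = (if node_dist h g \<le> sup (c A) (c B) then c B else node_dist h g)"

lemma dist_refl [simp]: "node_dist u u = bot"
  by (cases u) auto

lemma dist_exit:
  assumes "Between h g A B \<noteq> v" "size v \<le> size (Between h g A B)"
  shows "node_dist (Between h g A B) v = sup (exit_cost h g A B) (node_dist g v)"
  using assms by (cases v) (auto simp: exit_cost_def)

text \<open>When sizes tie, the recursion leaves the left node first. Entering the right node first
  gives the same value, as the two costs are joined independently.\<close>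

lemma dist_enter:
  assumes "u \<noteq> Between h g A B" "size u \<le> size (Between h g A B)"
  shows "node_dist u (Between h g A B) = sup (node_dist u h) (c A)"
proof (cases u)
  case (Between h' g' A' B')
  show ?thesis
  proof (cases "size (Between h g A B) \<le> size u")
    case True
    have "node_dist u (Between h g A B) = sup (exit_cost h' g' A' B') (node_dist g' (Between h g A B))"
      using True assms Between by (intro dist_exit[of h' g' A' B', folded Between]) auto
    moreover have "node_dist g' (Between h g A B) = sup (node_dist g' h) (c A)"
      using assms Between by (cases g') auto
    moreover have "node_dist u h = sup (exit_cost h' g' A' B') (node_dist g' h)"
      using True Between by (intro dist_exit[of h' g' A' B', folded Between]) auto
    ultimately show ?thesis by (simp add: sup_assoc)
  next
    case False
    then show ?thesis using assms Between by auto
  qed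
qed (use assms in auto)

lemma dist_le_exit_cost: "node_dist h g \<le> sup (c A) (exit_cost h g A B)"
  by (simp add: exit_cost_def)

text \<open>A largest node is unfolded. If it is an endpoint, its cost splits off on both sides; if
  it is the middle node, the path runs from \<open>h\<close> through it to \<open>g\<close>, and
  \<open>dist_le_exit_cost\<close> excludes a short cut.\<close>

lemma dist_triangle: "node_dist x z \<le> sup (node_dist x y) (node_dist y z)"
proof (induction "size x + size y + size z" arbitrary: x y z rule: less_induct)
  case less
  show ?case
  proof (cases "x = y \<or> y = z \<or> x = z")
    case False
    then have neq: "x \<noteq> y" "y \<noteq> z" "x \<noteq> z" by auto
    consider "size y \<le> size x" "size z \<le> size x" | "size x \<le> size z" "size y \<le> size z"
      | "size x \<le> size y" "size z \<le> size y" by linarith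
    then show ?thesis
    proof cases
      case 1
      show ?thesis
      proof (cases x)
        case (Base A)
        then show ?thesis using 1 neq by (cases y; cases z) (auto intro: le_supI1 le_supI2)
      next
        case (Between h g A B)
        have "node_dist g z \<le> sup (node_dist g y) (node_dist y z)" by (rule less) (simp add: Between)
        then have "sup (exit_cost h g A B) (node_dist g z)
            \<le> sup (sup (exit_cost h g A B) (node_dist g y)) (node_dist y z)"
          by (simp add: sup_assoc le_supI2)
        then show ?thesis using 1 neq Between by (simp add: dist_exit)
      qed
    next
      case 2
      show ?thesis
      proof (cases z)
        case (Base A)
        then show ?thesis using 2 neq by (cases x; cases y) (auto intro: le_supI1 le_supI2)
      next
        case (Between h g A B)
        have "node_dist x h \<le> sup (node_dist x y) (node_dist y h)" by (rule less) (simp add: Between)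
        then have "sup (node_dist x h) (c A) \<le> sup (node_dist x y) (sup (node_dist y h) (c A))"
          by (metis sup_assoc sup_mono order_refl)
        then show ?thesis using 2 neq Between by (simp add: dist_enter)
      qed
    next
      case 3
      show ?thesis
      proof (cases y)
        case (Base A)
        then show ?thesis using 3 neq by (cases x; cases z) (auto intro: le_supI1 le_supI2)
      next
        case (Between h g A B)
        have "node_dist x z \<le> sup (node_dist x h) (node_dist h z)" by (rule less) (simp add: Between)
        moreover have "node_dist h z \<le> sup (node_dist h g) (node_dist g z)"
          by (rule less) (simp add: Between)
        ultimately have "node_dist x z
            \<le> sup (node_dist x h) (sup (sup (c A) (exit_cost h g A B)) (node_dist g z))"
          using dist_le_exit_cost[of h g A B] by (meson order_refl order_trans sup_mono)
        then have "node_dist x z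
            \<le> sup (sup (node_dist x h) (c A)) (sup (exit_cost h g A B) (node_dist g z))"
          by (simp only: sup_assoc)
        then show ?thesis using 3 neq Between by (simp add: dist_enter dist_exit)
      qed
    qed
  qed auto
qed

lemma dist_midpoint:
  assumes "node_dist h g \<le> sup (c A) (c B)"
  shows "node_dist h (Between h g A B) = c A" "node_dist (Between h g A B) g = c B"
proof -
  have "size h < size (Between h g A B)" "size g < size (Between h g A B)" by simp_all
  then have "h \<noteq> Between h g A B" "g \<noteq> Between h g A B" by (metis less_irrefl)+
  then show "node_dist h (Between h g A B) = c A" "node_dist (Between h g A B) g = c B"
    using assms by (simp_all add: dist_enter dist_exit exit_cost_def)
qed

lemma compact_node_dist:
  assumes "\<And>A. compact_element (c A)"
  shows "compact_element (node_dist u v)"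
  by (induction u v rule: node_dist.induct) (auto intro: compact_bot compact_sup assms)

end

subsection \<open>Fibred sets and the monoids of a lattice element\<close>

locale sections =
  fixes fib :: "'x \<Rightarrow> 'x set" and s :: "'n \<Rightarrow> 'x set \<Rightarrow> 'x" and dead :: "'x set \<Rightarrow> 'x"
  assumes finite_fib: "finite (fib y)"
    and fib_s: "finite F \<Longrightarrow> fib (s h F) = F"
    and fib_dead: "finite F \<Longrightarrow> fib (dead F) = F"
    and s_neq_dead: "finite F \<Longrightarrow> s h F \<noteq> dead F"
    and separated: "h \<noteq> h' \<Longrightarrow> \<exists>Z. finite Z \<and> (\<forall>F. finite F \<longrightarrow> Z \<subseteq> F \<longrightarrow> s h F \<noteq> s h' F)"
begin

section \<open>Germs of edge maps\<close>

definition edge :: "'n \<Rightarrow> 'n \<Rightarrow> 'x \<Rightarrow> 'x" where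
  "edge h g y = (if y = s h (fib y) then s g (fib y) else dead (fib y))"

text \<open>Equality along the filter generated by the sets \<open>{y. Z \<subseteq> fib y}\<close>
  with \<open>Z\<close> finite.\<close>

definition germ_eq :: "('x \<Rightarrow> 'x) \<Rightarrow> ('x \<Rightarrow> 'x) \<Rightarrow> bool" where
  "germ_eq \<phi> \<psi> \<longleftrightarrow> (\<exists>Z. finite Z \<and> (\<forall>y. Z \<subseteq> fib y \<longrightarrow> \<phi> y = \<psi> y))"

definition fibrewise :: "('x \<Rightarrow> 'x) \<Rightarrow> bool" where
  "fibrewise \<phi> \<longleftrightarrow> (\<forall>y. fib (\<phi> y) = fib y)"

lemma germ_eq_refl [simp]: "germ_eq \<phi> \<phi>"
  by (auto simp: germ_eq_def)

lemma germ_eq_sym: "germ_eq \<phi> \<psi> \<Longrightarrow> germ_eq \<psi> \<phi>"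
  by (auto simp: germ_eq_def)

lemma germ_eq_trans:
  assumes "germ_eq \<phi> \<psi>" "germ_eq \<psi> \<chi>"
  shows "germ_eq \<phi> \<chi>"
proof -
  obtain Z Z' where "finite Z" "\<forall>y. Z \<subseteq> fib y \<longrightarrow> \<phi> y = \<psi> y"
    "finite Z'" "\<forall>y. Z' \<subseteq> fib y \<longrightarrow> \<psi> y = \<chi> y"
    using assms unfolding germ_eq_def by blast
  then show ?thesis unfolding germ_eq_def by (intro exI[of _ "Z \<union> Z'"]) simp
qed

text \<open>Since \<open>\<psi>\<close> keeps every point in its fibre, a threshold that serves
  \<open>\<phi>\<close> at \<open>y\<close> also serves it at \<open>\<psi> y\<close>.\<close>

lemma germ_eq_comp:
  assumes "fibrewise \<psi>" "germ_eq \<phi> \<phi>'" "germ_eq \<psi> \<psi>'"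
  shows "germ_eq (\<phi> \<circ> \<psi>) (\<phi>' \<circ> \<psi>')"
proof -
  obtain Z Z' where "finite Z" "\<forall>y. Z \<subseteq> fib y \<longrightarrow> \<phi> y = \<phi>' y"
    "finite Z'" "\<forall>y. Z' \<subseteq> fib y \<longrightarrow> \<psi> y = \<psi>' y"
    using assms unfolding germ_eq_def by blast
  moreover have "fib (\<psi> y) = fib y" for y
    using assms(1) by (simp add: fibrewise_def)
  ultimately have "\<phi> (\<psi> y) = \<phi>' (\<psi> y)" "\<psi> y = \<psi>' y" if "Z \<union> Z' \<subseteq> fib y" for y
    using that by (metis Un_subset_iff)+
  then show ?thesis unfolding germ_eq_def using \<open>finite Z\<close> \<open>finite Z'\<close>
    by (intro exI[of _ "Z \<union> Z'"]) simp
qed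

lemma fib_edge [simp]: "fib (edge h g y) = fib y"
  by (simp add: edge_def fib_s fib_dead finite_fib)

lemma fib_dead_fib [simp]: "fib (dead (fib y)) = fib y"
  by (simp add: fib_dead finite_fib)

lemma edge_dead [simp]: "edge h g (dead (fib y)) = dead (fib y)"
  using s_neq_dead[OF finite_fib[of y], of h] by (simp add: edge_def)

lemma edge_s: "finite F \<Longrightarrow> edge h g (s h F) = s g F"
  by (simp add: edge_def fib_s)

lemma edge_comp: "edge u g (edge h u y) = edge h g y"
  by (simp add: edge_def[of h] edge_s finite_fib)

text \<open>Over large \<open>F\<close> the traces of \<open>u\<close> and \<open>u'\<close> differ,
  so \<open>edge u g\<close> kills everything that \<open>edge h u'\<close> reaches.\<close>

lemma edge_comp_dead:
  assumes "u \<noteq> u'"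
  shows "germ_eq (edge u g \<circ> edge h u') (dead \<circ> fib)"
proof -
  obtain Z where Z: "finite Z" "\<forall>F. finite F \<longrightarrow> Z \<subseteq> F \<longrightarrow> s u F \<noteq> s u' F"
    using separated[OF assms] by blast
  have "edge u g (edge h u' y) = dead (fib y)" if "Z \<subseteq> fib y" for y
    using Z(2)[rule_format, OF finite_fib that]
    by (simp add: edge_def[of h] edge_def[of u g "s u' (fib y)"] fib_s finite_fib)
  then show ?thesis using Z(1) by (auto simp: germ_eq_def)
qed

lemma edge_not_dead: "\<not> germ_eq (edge h g) (dead \<circ> fib)"
proof
  assume "germ_eq (edge h g) (dead \<circ> fib)"
  then obtain Z where Z: "finite Z" "\<forall>y. Z \<subseteq> fib y \<longrightarrow> edge h g y = dead (fib y)"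
    unfolding germ_eq_def by auto
  then show False using Z(2)[rule_format, of "s h Z"] s_neq_dead[of Z g] by (simp add: edge_s fib_s)
qed

lemma s_eqI:
  assumes "finite Z" "\<And>F. finite F \<Longrightarrow> Z \<subseteq> F \<Longrightarrow> s h F = s h' F"
  shows "h = h'"
proof (rule ccontr)
  assume "h \<noteq> h'"
  then obtain Y where "finite Y" "\<forall>F. finite F \<longrightarrow> Y \<subseteq> F \<longrightarrow> s h F \<noteq> s h' F"
    using separated[OF \<open>h \<noteq> h'\<close>] by blast
  then show False using assms(1) assms(2)[of "Z \<union> Y"] by simp
qed

lemma edge_germ_id:
  assumes "germ_eq (edge h g) id"
  shows "h = g"
proof -
  obtain Z where Z: "finite Z" "\<forall>y. Z \<subseteq> fib y \<longrightarrow> edge h g y = y"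
    using assms unfolding germ_eq_def by auto
  have eq: "s h F = s g F" if "finite F" "Z \<subseteq> F" for F
    using Z(2)[rule_format, of "s h F"] that by (simp add: edge_s fib_s)
  show ?thesis by (rule s_eqI[OF Z(1) eq])
qed

text \<open>In the fibre over \<open>F\<close>, only \<open>s h F\<close> escapes the dead point
  under \<open>edge h g\<close>, and it goes to \<open>s g F\<close>; the traces over all large
  \<open>F\<close> determine the nodes.\<close>

lemma edge_germ_inject:
  assumes "germ_eq (edge h g) (edge h' g')"
  shows "h = h' \<and> g = g'"
proof -
  obtain Z where Z: "finite Z" "\<forall>y. Z \<subseteq> fib y \<longrightarrow> edge h g y = edge h' g' y"
    using assms unfolding germ_eq_def by auto
  have eq: "s h F = s h' F \<and> s g F = s g' F" if "finite F" "Z \<subseteq> F" for F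
    using Z(2)[rule_format, of "s h F"] that s_neq_dead[of F g]
    by (auto simp: edge_s fib_s edge_def[of h' g'] split: if_splits)
  show ?thesis using s_eqI[OF Z(1), of h h'] s_eqI[OF Z(1), of g g'] eq by simp
qed

end

section \<open>Composition monoids attached to lattice elements\<close>

locale distance_sections = sections fib s dead
  for fib :: "'x \<Rightarrow> 'x set" and s :: "'n \<Rightarrow> 'x set \<Rightarrow> 'x" and dead +
  fixes d :: "'n \<Rightarrow> 'n \<Rightarrow> 'l::algebraic_lattice"
  assumes d_refl: "d h h = bot"
    and d_triangle: "d h g \<le> sup (d h u) (d u g)"
    and d_compact: "compact_element (d h g)"
    and d_midpoint: "compact_element a \<Longrightarrow> compact_element b \<Longrightarrow> d h g \<le> sup a b \<Longrightarrow>
      \<exists>u. d h u \<le> a \<and> d u g \<le> b"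
    and d_onto: "compact_element a \<Longrightarrow> \<exists>h g. d h g = a"
begin

text \<open>Germs are needed for closure under composition: distinct nodes may share traces over
  small \<open>F\<close>, so two edges that do not meet compose to the dead map only
  eventually.\<close>

definition monoid_of :: "'l \<Rightarrow> ('x \<Rightarrow> 'x) set" where
  "monoid_of x = {\<phi>. fibrewise \<phi> \<and> (germ_eq \<phi> id \<or> germ_eq \<phi> (dead \<circ> fib) \<or>
     (\<exists>h g. d h g \<le> x \<and> germ_eq \<phi> (edge h g)))}"

lemma id_in_monoid_of: "id \<in> monoid_of x"
  by (simp add: monoid_of_def fibrewise_def)

lemma monoid_of_mono: "x \<le> y \<Longrightarrow> monoid_of x \<subseteq> monoid_of y"
  unfolding monoid_of_def by (auto intro: order_trans)

lemma edge_in_monoid_of: "d h g \<le> x \<Longrightarrow> edge h g \<in> monoid_of x"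
  using germ_eq_refl[of "edge h g"] unfolding monoid_of_def fibrewise_def by fastforce

text \<open>On germs the identity is neutral and the dead map absorbing. Edges that meet compose to
  an edge, bounded by the triangle inequality; all others compose to the dead germ.\<close>

lemma comp_in_monoid_of:
  assumes "\<phi> \<in> monoid_of x" "\<psi> \<in> monoid_of x"
  shows "\<phi> \<circ> \<psi> \<in> monoid_of x"
proof -
  have fw: "fibrewise \<phi>" "fibrewise \<psi>" using assms by (simp_all add: monoid_of_def)
  have comp: "germ_eq (\<phi> \<circ> \<psi>) \<chi>"
    if "germ_eq \<phi> \<phi>'" "germ_eq \<psi> \<psi>'" "germ_eq (\<phi>' \<circ> \<psi>') \<chi>" for \<phi>' \<psi>' \<chi>
    using germ_eq_trans[OF germ_eq_comp[OF fw(2) that(1,2)] that(3)] .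
  have germs: "germ_eq \<phi> id \<or> germ_eq \<phi> (dead \<circ> fib) \<or> (\<exists>h g. d h g \<le> x \<and> germ_eq \<phi> (edge h g))"
    "germ_eq \<psi> id \<or> germ_eq \<psi> (dead \<circ> fib) \<or> (\<exists>h g. d h g \<le> x \<and> germ_eq \<psi> (edge h g))"
    using assms by (simp_all add: monoid_of_def)
  have "germ_eq (\<phi> \<circ> \<psi>) id \<or> germ_eq (\<phi> \<circ> \<psi>) (dead \<circ> fib) \<or>
    (\<exists>h g. d h g \<le> x \<and> germ_eq (\<phi> \<circ> \<psi>) (edge h g))"
  proof (cases "germ_eq \<phi> id \<or> germ_eq \<psi> id")
    case True
    then show ?thesis
      using germs comp[of id] comp[of _ id] by (metis comp_id id_comp germ_eq_refl)
  next
    case nid: False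
    have dead: "germ_eq (\<phi> \<circ> \<psi>) (dead \<circ> fib)" if "germ_eq \<phi> (dead \<circ> fib)"
    proof -
      have "dead \<circ> fib \<circ> \<psi> = dead \<circ> fib"
        using fw(2) by (auto simp: fibrewise_def)
      then show ?thesis using comp[OF that germ_eq_refl] by simp
    qed
    show ?thesis
    proof (cases "germ_eq \<phi> (dead \<circ> fib)")
      case False
      then obtain u g where ug: "d u g \<le> x" "germ_eq \<phi> (edge u g)" using nid germs by blast
      show ?thesis
      proof (cases "germ_eq \<psi> (dead \<circ> fib)")
        case True
        have "edge u g \<circ> (dead \<circ> fib) = dead \<circ> fib" by auto
        then show ?thesis using comp[OF ug(2) True] by simp
      next
        case False
        then obtain h u' where hu: "d h u' \<le> x" "germ_eq \<psi> (edge h u')" using nid germs by blast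
        show ?thesis
        proof (cases "u = u'")
          case True
          then have "edge u g \<circ> edge h u' = edge h g" by (auto simp: edge_comp)
          then have "germ_eq (\<phi> \<circ> \<psi>) (edge h g)" using comp[OF ug(2) hu(2)] by simp
          moreover have "d h g \<le> x"
            using d_triangle[of h g u] ug(1) hu(1) True by (meson le_supI order_trans)
          ultimately show ?thesis by blast
        qed (use comp[OF ug(2) hu(2)] edge_comp_dead in blast)
      qed
    qed (use dead in blast)
  qed
  then show ?thesis using fw by (simp add: monoid_of_def fibrewise_def)
qed

text \<open>The germ of an edge is never dead, is the identity only if \<open>h = g\<close>, where
  the distance is \<open>bot\<close>, and determines the pair that witnesses membership.\<close>

lemma d_le_if_germ_edge:
  assumes "\<phi> \<in> monoid_of x" "germ_eq \<phi> (edge h g)"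
  shows "d h g \<le> x"
proof -
  have eq: "germ_eq (edge h g) \<psi>" if "germ_eq \<phi> \<psi>" for \<psi>
    using germ_eq_trans[OF germ_eq_sym[OF assms(2)] that] .
  show ?thesis
    using assms(1) edge_not_dead[of h g] edge_germ_id[of h g] edge_germ_inject[of h g] eq
    unfolding monoid_of_def by (auto simp: d_refl)
qed

lemma monoid_of_Inf:
  assumes "S \<noteq> {}" "\<And>x. x \<in> S \<Longrightarrow> \<phi> \<in> monoid_of x"
  shows "\<phi> \<in> monoid_of (Inf S)"
proof -
  obtain x where "x \<in> S" using assms(1) by blast
  then have "\<phi> \<in> monoid_of x" by (rule assms(2))
  moreover have "d h g \<le> Inf S" if "germ_eq \<phi> (edge h g)" for h g
    using that d_le_if_germ_edge assms(2) by (intro Inf_greatest) blast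
  ultimately show ?thesis unfolding monoid_of_def by blast
qed

text \<open>Each compact element below \<open>x\<close> is a distance, hence visible as an edge in
  \<open>monoid_of x\<close>.\<close>

lemma le_if_monoid_of_subset:
  assumes "monoid_of x \<subseteq> monoid_of y"
  shows "x \<le> y"
proof (rule le_if_compact_le)
  fix k assume "compact_element k" "k \<le> x"
  moreover then obtain h g where "d h g = k" using d_onto by blast
  ultimately show "k \<le> y"
    using assms edge_in_monoid_of[of h g x] d_le_if_germ_edge[of "edge h g" y h g] by auto
qed

text \<open>\<open>U\<close> stands for the unary part of an upper bound of the clones. By
  compactness an edge allowed by \<open>Sup S\<close> involves finitely many compact elements below
  members of \<open>S\<close>, and midpoints break it into edges allowed by single members.\<close>

lemma monoid_of_Sup:
  assumes "S \<noteq> {}" and U: "\<And>x. x \<in> S \<Longrightarrow> monoid_of x \<subseteq> U"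
    and U_comp: "\<And>\<phi> \<psi>. \<phi> \<in> U \<Longrightarrow> \<psi> \<in> U \<Longrightarrow> \<phi> \<circ> \<psi> \<in> U"
  shows "monoid_of (Sup S) \<subseteq> U"
proof
  fix \<phi> assume \<phi>: "\<phi> \<in> monoid_of (Sup S)"
  obtain x\<^sub>0 where x\<^sub>0: "x\<^sub>0 \<in> S" using assms(1) by blast
  \<comment> \<open>All fibrewise maps with the germ of the edge are demanded, because
    \<open>monoid_of (Sup S)\<close> contains them all.\<close>
  define R where "R h g \<longleftrightarrow> {\<phi>. fibrewise \<phi> \<and> germ_eq \<phi> (edge h g)} \<subseteq> U" for h g
  have R_le: "R h g" if "d h g \<le> x" "x \<in> S" for h g x
    using that U unfolding R_def monoid_of_def by blast
  have R_trans: "R h g" if "R h u" "R u g" for h u g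
    unfolding R_def
  proof clarify
    fix \<phi> assume fw: "fibrewise \<phi>" and "germ_eq \<phi> (edge h g)"
    then obtain Z where Z: "finite Z" "\<forall>y. Z \<subseteq> fib y \<longrightarrow> \<phi> y = edge h g y"
      unfolding germ_eq_def by blast
    \<comment> \<open>Where \<open>\<phi>\<close> need not be an edge, \<open>\<phi>\<^sub>1\<close> performs \<open>\<phi>\<close> and \<open>\<phi>\<^sub>2\<close> does nothing.\<close>
    define \<phi>\<^sub>1 where "\<phi>\<^sub>1 y = (if Z \<subseteq> fib y then edge h u y else \<phi> y)" for y
    define \<phi>\<^sub>2 where "\<phi>\<^sub>2 y = (if Z \<subseteq> fib y then edge u g y else y)" for y
    have "fibrewise \<phi>\<^sub>1" "fibrewise \<phi>\<^sub>2" "germ_eq \<phi>\<^sub>1 (edge h u)" "germ_eq \<phi>\<^sub>2 (edge u g)"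
      using fw Z(1) by (auto simp: \<phi>\<^sub>1_def \<phi>\<^sub>2_def fibrewise_def germ_eq_def)
    then have "\<phi>\<^sub>2 \<circ> \<phi>\<^sub>1 \<in> U" using that U_comp unfolding R_def by blast
    moreover have "\<phi>\<^sub>2 \<circ> \<phi>\<^sub>1 = \<phi>"
      using fw Z(2) by (auto simp: \<phi>\<^sub>1_def \<phi>\<^sub>2_def fibrewise_def edge_comp)
    ultimately show "\<phi> \<in> U" by simp
  qed
  have R_chain: "R h g"
    if "finite C" "C \<subseteq> {k. compact_element k \<and> (\<exists>x\<in>S. k \<le> x)}" "d h g \<le> Sup C" for C h g
    using that
  proof (induction C arbitrary: h g)
    case empty
    then have "d h g \<le> x\<^sub>0" by (simp add: bot_unique)
    then show ?case using R_le x\<^sub>0 by blast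
  next
    case (insert a C)
    \<comment> \<open>The midpoint splits off one leg of cost at most \<open>a\<close>; the rest is
      left to the induction.\<close>
    then obtain u where u: "d h u \<le> a" "d u g \<le> Sup C"
      using d_midpoint[of a "Sup C" h g] compact_Sup_finite[of C] by auto
    then have "R h u" using insert.prems(1) R_le by (auto intro: order_trans)
    moreover have "R u g" using insert u by auto
    ultimately show ?case by (rule R_trans)
  qed
  have R: "R h g" if "d h g \<le> Sup S" for h g
  proof -
    define A where "A = {k. compact_element k \<and> (\<exists>x\<in>S. k \<le> x)}"
    have "Sup S \<le> Sup A"
    proof (rule Sup_least)
      fix x assume "x \<in> S"
      show "x \<le> Sup A"
        by (rule le_if_compact_le) (use \<open>x \<in> S\<close> in \<open>auto simp: A_def intro!: Sup_upper\<close>)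
    qed
    then have "d h g \<le> Sup A" using that by (rule order_trans[rotated])
    then obtain C where "finite C" "C \<subseteq> A" "d h g \<le> Sup C"
      using d_compact[of h g] unfolding compact_element_def by blast
    then show ?thesis using R_chain unfolding A_def by blast
  qed
  show "\<phi> \<in> U"
  proof (cases "\<exists>h g. d h g \<le> Sup S \<and> germ_eq \<phi> (edge h g)")
    case True
    then show ?thesis using \<phi> R unfolding R_def monoid_of_def by blast
  next
    case False
    then have "\<phi> \<in> monoid_of x\<^sub>0" using \<phi> unfolding monoid_of_def by blast
    then show ?thesis using U x\<^sub>0 by blast
  qed
qed

end

subsection \<open>Essentially unary clones\<close>

definition unary_op :: "('x \<Rightarrow> 'x) \<Rightarrow> nat \<Rightarrow> nat \<Rightarrow> 'x list \<Rightarrow> 'x" where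
  "unary_op \<phi> n i = (\<lambda>xs\<in>tuples n. \<phi> (xs ! i))"

definition unary_ops :: "('x \<Rightarrow> 'x) set \<Rightarrow> 'x operation set" where
  "unary_ops M = {(n, unary_op \<phi> n i) | \<phi> n i. \<phi> \<in> M \<and> i < n}"

lemma unary_op_id: "unary_op id n i = Defs.proj n i"
  by (simp add: unary_op_def Defs.proj_def)

lemma compose_unary_op:
  assumes "length gs = n" "i < n" "gs ! i = unary_op \<psi> m j"
  shows "compose_ops m (unary_op \<phi> n i) gs = unary_op (\<phi> \<circ> \<psi>) m j"
  using assms by (auto simp: compose_ops_def unary_op_def tuples_def fun_eq_iff)

lemma is_clone_unary_ops:
  assumes "id \<in> M" "\<And>\<phi> \<psi>. \<phi> \<in> M \<Longrightarrow> \<psi> \<in> M \<Longrightarrow> \<phi> \<circ> \<psi> \<in> M"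
  shows "is_clone (unary_ops M)"
  unfolding is_clone_def
proof (intro conjI allI impI)
  show "unary_ops M \<subseteq> operations"
    by (auto simp: unary_ops_def operations_def unary_op_def)
  show "(n, Defs.proj n i) \<in> unary_ops M" if "i < n" for n i
    using that assms(1) unfolding unary_ops_def unary_op_id[symmetric] by blast
  fix n m f gs
  assume *: "(n, f) \<in> unary_ops M \<and> length gs = n \<and> (\<forall>g\<in>set gs. (m, g) \<in> unary_ops M)"
  then obtain \<phi> i where \<phi>: "f = unary_op \<phi> n i" "\<phi> \<in> M" "i < n"
    by (auto simp: unary_ops_def)
  then have "(m, gs ! i) \<in> unary_ops M" using * by auto
  then obtain \<psi> j where \<psi>: "gs ! i = unary_op \<psi> m j" "\<psi> \<in> M" "j < m"
    by (auto simp: unary_ops_def)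
  show "(m, compose_ops m f gs) \<in> unary_ops M"
    using * \<phi> \<psi> assms(2) compose_unary_op[of gs n i \<psi> m j \<phi>] by (auto simp: unary_ops_def)
qed

lemma unary_op_in_unary_ops:
  assumes "(n, unary_op \<phi> n i) \<in> unary_ops M" "i < n"
  shows "\<phi> \<in> M"
proof -
  obtain \<psi> j where \<psi>: "unary_op \<phi> n i = unary_op \<psi> n j" "\<psi> \<in> M" "j < n"
    using assms(1) by (auto simp: unary_ops_def)
  \<comment> \<open>On constant tuples the choice of coordinate does not matter.\<close>
  have "\<phi> y = \<psi> y" for y
    using fun_cong[OF \<psi>(1), of "replicate n y"] assms(2) \<psi>(3)
    by (simp add: unary_op_def tuples_def)
  then show ?thesis using \<psi>(2) by (metis ext)
qed

text \<open>Composing unary members with projections yields their copies in all arities, so the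
  unary part of \<open>E\<close> decides.\<close>

lemma unary_ops_subset_clone:
  assumes "is_clone E"
  shows "unary_ops M \<subseteq> E \<longleftrightarrow> M \<subseteq> {\<phi>. (1, unary_op \<phi> 1 0) \<in> E}"
proof
  show "M \<subseteq> {\<phi>. (1, unary_op \<phi> 1 0) \<in> E}" if "unary_ops M \<subseteq> E"
    using that by (force simp: unary_ops_def)
  assume M: "M \<subseteq> {\<phi>. (1, unary_op \<phi> 1 0) \<in> E}"
  show "unary_ops M \<subseteq> E"
  proof (clarsimp simp: unary_ops_def)
    fix \<phi> and n i :: nat assume "\<phi> \<in> M" "i < n"
    then have "(1, unary_op \<phi> 1 0) \<in> E" "(n, Defs.proj n i) \<in> E"
      using M assms by (auto simp: is_clone_def)
    then have "(n, compose_ops n (unary_op \<phi> 1 0) [Defs.proj n i]) \<in> E"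
      using assms unfolding is_clone_def by (metis empty_iff empty_set length_Cons list.size(3)
          One_nat_def set_ConsD)
    moreover have "compose_ops n (unary_op \<phi> 1 0) [Defs.proj n i] = unary_op \<phi> n i"
      using compose_unary_op[of "[Defs.proj n i]" 1 0 id n i \<phi>] by (simp add: unary_op_id)
    ultimately show "(n, unary_op \<phi> n i) \<in> E" by simp
  qed
qed

lemma clone_unary_comp:
  assumes "is_clone E" "(1, unary_op \<phi> 1 0) \<in> E" "(1, unary_op \<psi> 1 0) \<in> E"
  shows "(1, unary_op (\<phi> \<circ> \<psi>) 1 0) \<in> E"
proof -
  have "(1, compose_ops 1 (unary_op \<phi> 1 0) [unary_op \<psi> 1 0]) \<in> E"
    using assms unfolding is_clone_def by simp
  then show ?thesis using compose_unary_op[of "[unary_op \<psi> 1 0]" 1 0 \<psi> 1 0 \<phi>] by simp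
qed

section \<open>The embedding into the clone lattice\<close>

context distance_sections
begin

lemma is_clone_monoid_of: "is_clone (unary_ops (monoid_of x))"
  by (intro is_clone_unary_ops id_in_monoid_of comp_in_monoid_of)

definition clone_of :: "'l \<Rightarrow> 'x clone" where
  "clone_of x = Abs_clone (unary_ops (monoid_of x))"

lemma Rep_clone_of: "Rep_clone (clone_of x) = unary_ops (monoid_of x)"
  by (simp add: clone_of_def Abs_clone_inverse is_clone_monoid_of)

lemma clone_of_le_iff:
  "clone_of x \<le> E \<longleftrightarrow> monoid_of x \<subseteq> {\<phi>. (1, unary_op \<phi> 1 0) \<in> Rep_clone E}"
  using unary_ops_subset_clone[of "Rep_clone E"] Rep_clone[of E]
  by (simp add: less_eq_clone.rep_eq Rep_clone_of)

lemma clone_of_le_clone_of_iff: "clone_of x \<le> clone_of y \<longleftrightarrow> x \<le> y"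
proof
  show "clone_of x \<le> clone_of y" if "x \<le> y"
    using monoid_of_mono[OF that] by (auto simp: less_eq_clone.rep_eq Rep_clone_of unary_ops_def)
  assume "clone_of x \<le> clone_of y"
  then have "monoid_of x \<subseteq> monoid_of y"
    using unary_op_in_unary_ops[of 1 _ 0] by (auto simp: clone_of_le_iff Rep_clone_of)
  then show "x \<le> y" by (rule le_if_monoid_of_subset)
qed

lemma inj_clone_of: "inj clone_of"
  by (rule injI) (metis clone_of_le_clone_of_iff order_antisym order_refl)

text \<open>The generated clone need not be described: the unary part of the supremum contains the
  monoids of all members and is closed under composition, so \<open>monoid_of_Sup\<close>
  applies.\<close>

lemma clone_of_Sup:
  assumes "S \<noteq> {}"
  shows "clone_of (Sup S) = Sup (clone_of ` S)"
proof (rule order_antisym)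
  define E where "E = Sup (clone_of ` S)"
  have E: "is_clone (Rep_clone E)" using Rep_clone[of E] by simp
  have "clone_of x \<le> E" if "x \<in> S" for x
    using that unfolding E_def by (intro Sup_upper) blast
  then show "clone_of (Sup S) \<le> Sup (clone_of ` S)"
    unfolding clone_of_le_iff E_def[symmetric]
    using clone_unary_comp[OF E] by (intro monoid_of_Sup assms) auto
  show "Sup (clone_of ` S) \<le> clone_of (Sup S)"
    by (auto intro!: Sup_least Sup_upper simp: clone_of_le_clone_of_iff)
qed

lemma clone_of_Inf:
  assumes "S \<noteq> {}"
  shows "clone_of (Inf S) = Inf (clone_of ` S)"
proof (rule order_antisym)
  show "clone_of (Inf S) \<le> Inf (clone_of ` S)"
    by (auto intro!: Inf_greatest Inf_lower simp: clone_of_le_clone_of_iff)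
  have "p \<in> unary_ops (monoid_of (Inf S))"
    if p: "\<And>x. x \<in> S \<Longrightarrow> p \<in> unary_ops (monoid_of x)" for p
  proof -
    obtain \<phi> n i where \<phi>: "p = (n, unary_op \<phi> n i)" "i < n"
      using p assms by (fastforce simp: unary_ops_def)
    \<comment> \<open>With \<open>i\<close> fixed, \<open>p\<close> determines
      \<open>\<phi>\<close>, so the map found in one member serves for all.\<close>
    then have "\<phi> \<in> monoid_of x" if "x \<in> S" for x
      using p[OF that] unary_op_in_unary_ops by blast
    then have "\<phi> \<in> monoid_of (Inf S)" using assms monoid_of_Inf by blast
    then show ?thesis using \<phi> by (auto simp: unary_ops_def)
  qed
  then show "Inf (clone_of ` S) \<le> clone_of (Inf S)"
    by (auto simp: less_eq_clone.rep_eq Inf_clone.rep_eq Rep_clone_of)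
qed

end

subsection \<open>Coding\<close>

lemma infinite_pairing:
  assumes "infinite (UNIV :: 'a set)"
  shows "\<exists>p :: 'a \<times> 'a \<Rightarrow> 'a. inj p"
  using card_of_Times_same_infinite[OF assms] by (auto simp: card_of_ordIso[symmetric] bij_betw_def)

lemma infinite_node_coding:
  assumes "infinite (UNIV :: 'a set)"
  shows "\<exists>code :: 'a node \<Rightarrow> 'a. inj code"
proof -
  obtain p :: "'a \<times> 'a \<Rightarrow> 'a" where p: "inj p" using infinite_pairing[OF assms] by blast
  obtain t\<^sub>0 t\<^sub>1 :: 'a where t: "t\<^sub>0 \<noteq> t\<^sub>1"
    using assms by (metis ex_new_if_finite finite.emptyI finite_insert insertI1)
  define code :: "'a node \<Rightarrow> 'a" where
    "code = rec_node (\<lambda>A. p (t\<^sub>0, A)) (\<lambda>h g A B k l. p (t\<^sub>1, p (p (k, l), p (A, B))))"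
  have code [simp]: "code (Base A) = p (t\<^sub>0, A)"
    "code (Between h g A B) = p (t\<^sub>1, p (p (code h, code g), p (A, B)))" for A B h g
    by (simp_all add: code_def)
  have "u = v" if "code u = code v" for u v
    using that
  proof (induction u arbitrary: v)
    case (Base A)
    then show ?case using t by (cases v) (auto simp: inj_eq[OF p])
  next
    case (Between h g A B)
    then show ?case using t by (cases v) (auto simp: inj_eq[OF p])
  qed
  then show ?thesis unfolding inj_def by blast
qed

text \<open>A point \<open>p (q F, w)\<close> is placed over \<open>F\<close>; inside
  \<open>w\<close>, a tag tells traces from the dead point.\<close>

lemma sections_exist:
  assumes "infinite (UNIV :: 'x set)" and code: "inj (code :: 'n \<Rightarrow> 'x set)"
  shows "\<exists>(fib :: 'x \<Rightarrow> 'x set) (s :: 'n \<Rightarrow> 'x set \<Rightarrow> 'x) dead. sections fib s dead"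
proof -
  obtain p :: "'x \<times> 'x \<Rightarrow> 'x" where p: "inj p" using infinite_pairing[OF assms(1)] by blast
  obtain t\<^sub>0 t\<^sub>1 :: 'x where t: "t\<^sub>0 \<noteq> t\<^sub>1"
    using assms(1) by (metis ex_new_if_finite finite.emptyI finite_insert insertI1)
  obtain q :: "'x set \<Rightarrow> 'x" where "inj_on q (Fpow UNIV)"
    using eqpoll_Fpow[OF assms(1)] unfolding eqpoll_def bij_betw_def by blast
  then have q: "q A = q B \<longleftrightarrow> A = B" if "finite A" "finite B" for A B
    using that by (auto simp: inj_on_def Fpow_def)
  \<comment> \<open>Points that are not such codes join the fibre over the empty set.\<close>
  define fib where "fib y = (if \<exists>F w. finite F \<and> y = p (q F, w)
    then THE F. finite F \<and> (\<exists>w. y = p (q F, w)) else {})" for y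
  define s where "s h F = p (q F, p (t\<^sub>0, q (code h \<inter> F)))" for h F
  define dead where "dead F = p (q F, p (t\<^sub>1, t\<^sub>1))" for F
  have fib: "fib (p (q F, w)) = F" if "finite F" for F w
  proof -
    have "(THE F'. finite F' \<and> (\<exists>w'. p (q F, w) = p (q F', w'))) = F"
      by (rule the_equality) (use that in \<open>auto simp: inj_eq[OF p] q\<close>)
    then show ?thesis using that by (auto simp: fib_def)
  qed
  have "sections fib s dead"
  proof
    show "finite (fib y)" for y
    proof (cases "\<exists>F w. finite F \<and> y = p (q F, w)")
      case True
      then show ?thesis using fib by auto
    next
      case False
      then have "fib y = {}" unfolding fib_def by (rule if_not_P)
      then show ?thesis by simp
    qed
    show "\<exists>Z. finite Z \<and> (\<forall>F. finite F \<longrightarrow> Z \<subseteq> F \<longrightarrow> s h F \<noteq> s h' F)" if "h \<noteq> h'" for h h'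
    proof -
      \<comment> \<open>A point in just one of the two codes separates the traces over every
        \<open>F\<close> containing it.\<close>
      obtain y where "(y \<in> code h) \<noteq> (y \<in> code h')"
        using inj_eq[OF code, of h h'] \<open>h \<noteq> h'\<close> by blast
      then show ?thesis
        by (intro exI[of _ "{y}"]) (auto simp: s_def inj_eq[OF p] q)
    qed
  qed (use t in \<open>auto simp: s_def dead_def fib inj_eq[OF p]\<close>)
  then show ?thesis by blast
qed

theorem theorem1:
  assumes "infinite (UNIV :: 'x set)"
    and "{c :: 'l :: algebraic_lattice. compact_element c} \<lesssim> Pow (UNIV :: 'x set)"
  shows "\<exists>e :: 'l \<Rightarrow> 'x clone. inj e \<and>
           (\<forall>S. S \<noteq> {} \<longrightarrow> e (Sup S) = Sup (e ` S) \<and> e (Inf S) = Inf (e ` S))"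
proof -
  define K where "K = {c :: 'l. compact_element c}"
  obtain f :: "'l \<Rightarrow> 'x set" where "inj_on f K"
    using assms(2) unfolding K_def lepoll_def by blast
  moreover have "bot \<in> K" by (simp add: K_def compact_bot)
  \<comment> \<open>All subsets of X serve as labels; those that code no compact element get
    \<open>bot\<close>.\<close>
  ultimately have "\<exists>c. K = range (c :: 'x set \<Rightarrow> 'l)"
    by (intro exI[of _ "\<lambda>A. if A \<in> f ` K then inv_into K f A else bot"])
      (auto simp: inv_into_into image_iff intro: inv_into_f_f[symmetric])
  then obtain c :: "'x set \<Rightarrow> 'l" where c: "K = range c" ..
  have compact_c: "compact_element (c A)" for A
    using c by (auto simp: K_def)
  have c_onto: "\<exists>A. c A = a" if "compact_element a" for a
    using that c unfolding K_def by (metis mem_Collect_eq rangeE)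
  have "infinite (UNIV :: 'x set set)"
    using assms(1) by (simp add: Finite_Set.finite_set)
  then obtain code :: "'x set node \<Rightarrow> 'x set" where "inj code"
    using infinite_node_coding by blast
  then obtain fib :: "'x \<Rightarrow> 'x set" and s :: "'x set node \<Rightarrow> 'x set \<Rightarrow> 'x" and dead
    where "sections fib s dead"
    using sections_exist[OF assms(1)] by blast
  then interpret sections fib s dead .
  interpret distance_sections fib s dead "node_dist c"
  proof
    show "\<exists>u. node_dist c h u \<le> a \<and> node_dist c u g \<le> b"
      if ab: "compact_element a" "compact_element b" and le: "node_dist c h g \<le> sup a b" for a b h g
    proof -
      obtain A B where "c A = a" "c B = b" using c_onto ab by blast
      then show ?thesis
        using dist_midpoint[of c h g A B] le by (intro exI[of _ "Between h g A B"]) simp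
    qed
    show "\<exists>h g. node_dist c h g = a" if a: "compact_element a" for a
    proof -
      \<comment> \<open>With \<open>c A = bot\<close>, the distance of the two base nodes is
        \<open>c B\<close>; if \<open>A = B\<close>, then \<open>a = bot\<close> as well.\<close>
      obtain A B where "c A = bot" "c B = a" using c_onto compact_bot a by blast
      then show ?thesis by (intro exI[of _ "Base A"] exI[of _ "Base B"]) auto
    qed
  qed (simp_all add: dist_triangle compact_node_dist compact_c)
  show ?thesis
    using inj_clone_of clone_of_Sup clone_of_Inf by blast
qed

end
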